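(* For every integer $b \geqslant 2$, one has $\ell(b) = (b-1)\beta(b)$.
   Context: For an integer $b\geqslant 2$ and a set $S\subseteq [0,b-1]=\{0,1,\dots,b-1\}$, the Kempner set $\mathcal{K}(S,b)$ is the set of non-negative integers whose base-$b$ expansions use only digits from $S$. A set $S$ is called permitted if $0\in S$ and $S\neq[0,b-1]$; then $\mathcal{K}(S,b)$ is called a proper Kempner set. $\ell(b)$ denotes the length (number of terms) of the longest arithmetic progression (with nonzero common difference) contained in some proper Kempner set of base $b$. For a positive integer $n$, $\rho(n)$ is the product of the distinct primes dividing $n$, and $\beta(b)$ is the largest positive integer $m<b$ such that $\rho(m)\mid b$ (equivalently, the largest integer less than $b$ dividing some power of $b$). *)

theory Defs
  imports Complex_Main "HOL-Library.Extended_Nat" "HOL-Computational_Algebra.Primes"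
begin

(* The digit of n at position i in base b is n div b ^ i mod b.  Only the positions that
   actually occur in the expansion are constrained: leading zeros are not counted, and the
   expansion of 0 is the single digit 0. *)
definition kempner_set :: "nat set \<Rightarrow> nat \<Rightarrow> nat set" where
  "kempner_set S b = {n. \<forall>i. i = 0 \<or> b ^ i \<le> n \<longrightarrow> n div b ^ i mod b \<in> S}"

definition permitted :: "nat \<Rightarrow> nat set \<Rightarrow> bool" where
  "permitted b S \<longleftrightarrow> S \<subseteq> {0..b - 1} \<and> 0 \<in> S \<and> S \<noteq> {0..b - 1}"

definition contains_AP :: "nat set \<Rightarrow> nat \<Rightarrow> bool" where
  "contains_AP X k \<longleftrightarrow> (\<exists>a d :: int. d \<noteq> 0 \<and> (\<forall>i<k. a + int i * d \<in> int ` X))"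

(* The supremum is taken in enat, so that it is infinity when the lengths are unbounded; a
   finite value is attained, and is then the length of a longest progression. *)
definition ell :: "nat \<Rightarrow> enat" where
  "ell b = Sup {enat k | k. \<exists>S. permitted b S \<and> contains_AP (kempner_set S b) k}"

definition rho :: "nat \<Rightarrow> nat" where
  "rho n = \<Prod>(prime_factors n)"

definition beta :: "nat \<Rightarrow> nat" where
  "beta b = Max {m. 0 < m \<and> m < b \<and> rho m dvd b}"

end

(* Lower bound: write b ^ k = m * D with m = beta b.  The multiples j * D with j < (b - 1) * m
   are the numbers (j / m) * b ^ k; since m < b, the fractional part of j / m never produces
   the digit b - 1, and its integral part is less than b - 1.

   Upper bound: let s > 0 be a missing digit.  Modulo b ^ t a progression with difference d
   runs cyclically through a residue class modulo gcd d (b ^ t), which has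
   q t = b ^ t / gcd d (b ^ t) elements, of which at least q t div b have digit s in
   position t - 1.  If t is least with q t \<ge> b, then q (t - 1) divides a power of b and is
   less than b, so it is at most beta b, whence b \<le> q t \<le> b * beta b and the progression has
   at most q t - q t div b \<le> (b - 1) * beta b terms. *)

theory Submission
  imports Defs
begin

section \<open>Radicals, divisors of powers of \<open>b\<close>, and \<open>beta\<close>\<close>

lemma dvd_rho_power:
  assumes "m > 0"
  shows "\<exists>k. m dvd rho m ^ k"
proof -
  \<comment> \<open>The number of prime factors counted with multiplicity bounds each single
    multiplicity.\<close>
  let ?k = "size (prime_factorization m)"
  have "m = (\<Prod>p\<in>prime_factors m. p ^ multiplicity p m)"
    using assms by (simp add: prod_prime_factors)
  also have "\<dots> dvd (\<Prod>p\<in>prime_factors m. p ^ ?k)"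
    by (intro prod_dvd_prod le_imp_power_dvd)
       (metis count_le_size count_prime_factorization_prime in_prime_factors_imp_prime)
  also have "\<dots> = rho m ^ ?k"
    by (simp add: rho_def prod_power_distrib)
  finally show ?thesis by blast
qed

lemma rho_dvd_self:
  assumes "m > 0"
  shows "rho m dvd m"
proof -
  have "rho m dvd (\<Prod>p\<in>prime_factors m. p ^ multiplicity p m)"
    unfolding rho_def
    by (intro prod_dvd_prod) (auto simp: prime_factors_multiplicity)
  also have "\<dots> = m"
    using assms by (simp add: prod_prime_factors)
  finally show ?thesis .
qed

text \<open>Only the set of primes matters: \<open>m\<close> divides a power of its radical, and
  conversely every prime of \<open>m\<close> must be a prime of \<open>b\<close>.\<close>

lemma rho_dvd_iff:
  assumes "m > 0" "b > 0"
  shows "rho m dvd b \<longleftrightarrow> (\<exists>k. m dvd b ^ k)"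
proof
  assume "rho m dvd b"
  then show "\<exists>k. m dvd b ^ k"
    using dvd_rho_power[OF assms(1)] by (meson dvd_power_same dvd_trans)
next
  assume "\<exists>k. m dvd b ^ k"
  then obtain k where k: "m dvd b ^ k" ..
  have "prime_factors m \<subseteq> prime_factors b"
  proof
    fix p assume p: "p \<in> prime_factors m"
    then have "prime p" "p dvd b ^ k"
      using k by (auto simp: in_prime_factors_iff intro: dvd_trans)
    then show "p \<in> prime_factors b"
      using assms prime_dvd_power by (auto simp: in_prime_factors_iff)
  qed
  then have "rho m dvd rho b"
    unfolding rho_def by (intro prod_dvd_prod_subset) auto
  then show "rho m dvd b"
    using rho_dvd_self[OF assms(2)] dvd_trans by blast
qed

lemma beta_properties:
  assumes "b \<ge> 2"
  shows "0 < beta b" "beta b < b" "\<exists>k. beta b dvd b ^ k"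
    and "\<And>m k. m < b \<Longrightarrow> m dvd b ^ k \<Longrightarrow> m \<le> beta b"
proof -
  let ?A = "{m. 0 < m \<and> m < b \<and> rho m dvd b}"
  have fin: "finite ?A" by simp
  \<comment> \<open>Nonemptiness makes the maximum a member of the set.\<close>
  have "1 \<in> ?A" using assms by (simp add: rho_def)
  then have "beta b \<in> ?A"
    unfolding beta_def using fin by (intro Max_in) auto
  then show "0 < beta b" "beta b < b" "\<exists>k. beta b dvd b ^ k"
    using assms by (auto simp: rho_dvd_iff)
  show "m \<le> beta b" if "m < b" "m dvd b ^ k" for m k
  proof -
    have "m > 0" using that assms by (intro Nat.gr0I) auto
    then have "m \<in> ?A" using that assms by (auto simp: rho_dvd_iff)
    then show ?thesis unfolding beta_def using fin by (rule Max_ge[rotated])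
  qed
qed

section \<open>Lower bound: a progression avoiding the digit \<open>b - 1\<close>\<close>

text \<open>Positions from \<open>k\<close> on show the digits of \<open>j div m\<close>, which is
  itself below \<open>b - 1\<close>. Lower positions belong to the fractional part of
  \<open>j / m\<close>, whose distance to the next integer is too large for a top digit.\<close>

lemma digit_ne_top:
  fixes b m D j k i :: nat
  assumes "0 < m" "m < b" "b ^ k = m * D" "j < (b - 1) * m"
  shows "j * D div b ^ i mod b < b - 1"
proof (cases "k \<le> i")
  case True
  have "D > 0" using assms by (intro Nat.gr0I) auto
  have "j * D div b ^ i = j * D div b ^ k div b ^ (i - k)"
    using True by (simp flip: div_mult2_eq power_add)
  also have "j * D div b ^ k = j div m"
    using assms(3) \<open>D > 0\<close> by (simp add: div_mult2_eq mult.commute)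
  also have "j div m div b ^ (i - k) \<le> j div m" by simp
  also have "\<dots> < b - 1" using assms by (simp add: less_mult_imp_div_less)
  finally show ?thesis by (meson le_less_trans mod_less_eq_dividend)
next
  case False
  define r where "r = j * D mod b ^ Suc i"
  have pos: "0 < b ^ Suc i" using assms by simp
  have digit: "j * D div b ^ i mod b = r div b ^ i"
    unfolding r_def power_Suc2 using assms by (simp add: mod_mult2_eq)
  have "b ^ Suc i dvd b ^ k" using False by (intro le_imp_power_dvd) simp
  then have "b ^ Suc i dvd m * (j * D)" using assms(3)
    by (metis dvd_mult mult.left_commute)
  then have "b ^ Suc i dvd m * r"
    unfolding r_def by (metis dvd_eq_mod_eq_0 mod_mult_right_eq)
  then obtain c where c: "m * r = b ^ Suc i * c" by (rule dvdE)
  have "r < b ^ Suc i" unfolding r_def using pos by simp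
  then have "b ^ Suc i * c < b ^ Suc i * m"
    using c assms(1) by (metis mult.commute mult_less_mono2)
  then have "c + 1 \<le> m" by simp
  show ?thesis
  proof (rule ccontr)
    \<comment> \<open>The digit \<open>b - 1\<close> would put \<open>r\<close> within
      \<open>b ^ i\<close> of \<open>b ^ Suc i\<close>. But \<open>m * r\<close> is a multiple of
      \<open>b ^ Suc i\<close> below \<open>m * b ^ Suc i\<close>, so the gap is at least
      \<open>b ^ Suc i / m\<close>, which exceeds \<open>b ^ i\<close> as
      \<open>m < b\<close>.\<close>
    assume "\<not> ?thesis"
    then have "b - 1 \<le> r div b ^ i" using digit by simp
    then have "(b - 1) * b ^ i \<le> r"
      by (meson div_times_less_eq_dividend le_trans mult_le_mono1)
    then have "b ^ Suc i \<le> r + b ^ i" using assms by (simp add: algebra_simps)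
    then have "m * b ^ Suc i \<le> b ^ Suc i * c + m * b ^ i"
      using c by (metis add_mult_distrib2 mult_le_mono2)
    moreover have "b ^ Suc i * (c + 1) \<le> m * b ^ Suc i"
      using \<open>c + 1 \<le> m\<close> by (metis mult.commute mult_le_mono2)
    ultimately have "b * b ^ i \<le> m * b ^ i"
      unfolding power_Suc add_mult_distrib2 by linarith
    then show False using assms by simp
  qed
qed

lemma contains_AP_beta:
  assumes "b \<ge> 2"
  shows "contains_AP (kempner_set {0..<b - 1} b) ((b - 1) * beta b)"
proof -
  obtain k D where D: "b ^ k = beta b * D"
    using beta_properties(3)[OF assms] by (auto elim!: dvdE)
  then have "D > 0" using assms by (intro Nat.gr0I) auto
  have "j * D \<in> kempner_set {0..<b - 1} b" if "j < (b - 1) * beta b" for j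
  proof -
    have "\<forall>i. j * D div b ^ i mod b \<in> {0..<b - 1}"
      using digit_ne_top[OF beta_properties(1,2)[OF assms] D that] by simp
    then show ?thesis unfolding kempner_set_def by blast
  qed
  then show ?thesis
    unfolding contains_AP_def using \<open>D > 0\<close>
    by (intro exI[of _ 0] exI[of _ "int D"]) (auto simp flip: of_nat_mult)
qed

section \<open>Upper bound: how often a digit occurs in a residue class\<close>

text \<open>A nonzero digit occurs only at positions with \<open>b ^ i \<le> n\<close>, exactly
  those where membership constrains the digits.\<close>

lemma kempner_set_digit_ne:
  assumes "n \<in> kempner_set S b" "s \<notin> S" "s > 0"
  shows "n div b ^ i mod b \<noteq> s"
proof
  assume s: "n div b ^ i mod b = s"
  then have "b ^ i \<le> n" using assms(3) by (metis div_less mod_0 not_less less_irrefl)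
  then show False using assms s by (auto simp: kempner_set_def)
qed

text \<open>Numbers below \<open>b * B\<close> with top digit \<open>s\<close> fill an interval of
  length \<open>B\<close>. Members of a class modulo \<open>g\<close> are spaced by
  \<open>g\<close>, and \<open>c\<close> is the floor of \<open>B / g\<close>, so at least
  \<open>c\<close> consecutive members fall into it.\<close>

lemma residues_with_digit:
  fixes a g B b s :: int
  assumes "0 < g" "0 < B" "g dvd b * B" "0 \<le> s" "s < b"
  defines "c \<equiv> (b * B div g) div b"
  shows "\<exists>y0. {y0..<y0 + c} \<subseteq> {y. s * B \<le> g * y + a mod g \<and> g * y + a mod g < (s + 1) * B}
              \<inter> {0..<b * B div g}"
proof -
  define r where "r = a mod g"
  have r: "0 \<le> r" "r < g" using assms by (auto simp: r_def)
  obtain q where q: "b * B = g * q" using assms(3) by (rule dvdE)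
  have qdiv: "b * B div g = q" using q assms(1) by simp
  have "b * (g * c) \<le> g * q"
  proof -
    have "b * c \<le> q"
      unfolding c_def qdiv using assms
      by (metis add_le_cancel_left add.right_neutral le_less_trans mult_div_mod_eq
          pos_mod_sign)
    then show ?thesis using assms(1) by (simp add: mult.left_commute[of b g])
  qed
  then have gc: "g * c \<le> B" using q assms by (metis dual_order.strict_trans2 mult_le_cancel_left_pos)
  \<comment> \<open>The ceiling of \<open>(s * B - r) / g\<close>, that is, the first index whose
    member reaches \<open>s * B\<close>.\<close>
  define y0 where "y0 = (s * B - r + g - 1) div g"
  have y0: "s * B - r \<le> g * y0" "g * y0 \<le> s * B - r + g - 1"
  proof -
    have "(s * B - r + g - 1) mod g < g" "0 \<le> (s * B - r + g - 1) mod g"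
      using assms(1) by auto
    moreover have "g * y0 + (s * B - r + g - 1) mod g = s * B - r + g - 1"
      unfolding y0_def by simp
    ultimately show "s * B - r \<le> g * y0" "g * y0 \<le> s * B - r + g - 1" by linarith+
  qed
  have "0 \<le> s * B" using assms by simp
  then have "0 \<le> y0" unfolding y0_def using r assms(1) by (simp add: pos_imp_zdiv_nonneg_iff)
  have "(s + 1) * B \<le> b * B" using assms by (intro mult_right_mono) auto
  have "s * B \<le> g * y + r \<and> g * y + r < (s + 1) * B \<and> 0 \<le> y \<and> y < q"
    if "y0 \<le> y" "y < y0 + c" for y
  proof -
    have "g * y0 \<le> g * y" using that assms by simp
    moreover have "g * y \<le> g * (y0 + c - 1)" using that assms by (intro mult_left_mono) auto
    ultimately have *: "s * B \<le> g * y + r" "g * y + r < (s + 1) * B"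
      using y0 gc unfolding ring_distribs by linarith+
    then have "g * y < g * q" using q r \<open>(s + 1) * B \<le> b * B\<close> by linarith
    then show ?thesis using * that \<open>0 \<le> y0\<close> assms(1) by simp
  qed
  then show ?thesis unfolding qdiv r_def[symmetric] by (intro exI[of _ y0] subsetI) auto
qed

text \<open>After cancelling the gcd, the step is coprime to \<open>M div gcd d M\<close>, so a
  collision forces this number to divide \<open>i - j\<close>.\<close>

lemma AP_mod_inj:
  fixes a d M :: int
  assumes "M > 0"
  shows "inj_on (\<lambda>i. (a + int i * d) mod M div gcd d M) {..<nat (M div gcd d M)}"
proof (rule inj_onI)
  fix i j
  define g where "g = gcd d M"
  have "g > 0" using assms by (simp add: g_def)
  obtain d' q where dq: "d = g * d'" "M = g * q" "coprime d' q"
    unfolding g_def using assms gcd_coprime_exists[of d M]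
    by (metis gcd_eq_0_iff less_irrefl mult.commute)
  have q: "M div gcd d M = q" using dq \<open>g > 0\<close> unfolding g_def[symmetric] by simp
  assume "i \<in> {..<nat (M div gcd d M)}" "j \<in> {..<nat (M div gcd d M)}"
  then have ij: "int i < q" "int j < q" unfolding q by auto
  assume eq: "(a + int i * d) mod M div gcd d M = (a + int j * d) mod M div gcd d M"
  \<comment> \<open>All terms share their remainder modulo \<open>g\<close>, so the quotient by
    \<open>g\<close> determines the term modulo \<open>M\<close>.\<close>
  have "(a + int n * d) mod M mod g = a mod g" for n
    using dq by (simp add: mod_mod_cancel mult.left_commute)
  then have "(a + int i * d) mod M = (a + int j * d) mod M"
    using eq unfolding g_def[symmetric] by (metis div_mult_mod_eq)
  then have "M dvd (int i - int j) * d"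
    by (simp add: mod_eq_dvd_iff algebra_simps)
  then have "g * q dvd g * ((int i - int j) * d')"
    using dq by (simp add: mult.left_commute)
  then have "q dvd (int i - int j) * d'" using \<open>g > 0\<close> by simp
  then have "q dvd int i - int j"
    using dq(3) by (simp add: coprime_dvd_mult_left_iff coprime_commute)
  moreover have "\<bar>int i - int j\<bar> < q" using ij by linarith
  ultimately show "i = j" using zdvd_not_zless
    by (metis dvd_imp_le_int eq_iff_diff_eq_0 not_less of_nat_eq_iff abs_of_pos abs_ge_zero
        le_less_trans)
qed

lemma digit_eq_mod_div:
  fixes x B b :: int
  assumes "B > 0" "b > 0"
  shows "x div B mod b = x mod (b * B) div B"
proof -
  have "x mod (B * b) = B * (x div B mod b) + x mod B"
    using assms by (simp add: zmod_zmult2_eq)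
  then show ?thesis using assms by (simp add: mult.commute)
qed

text \<open>The quotients \<open>f i\<close> are distinct indices in \<open>{0..<q}\<close> during
  one period, and none lies in the block of \<open>c\<close> indices that carry the digit
  \<open>s\<close>.\<close>

lemma AP_avoiding_digit_length:
  fixes a d :: int and b s k t :: nat
  assumes "s < b"
    and avoid: "\<And>i. i < k \<Longrightarrow> (a + int i * d) div int b ^ t mod int b \<noteq> int s"
    and q: "q = int b ^ Suc t div gcd d (int b ^ Suc t)" "int b \<le> q"
  shows "int k \<le> q - q div int b"
proof -
  define M where "M = int b ^ Suc t"
  define g where "g = gcd d M"
  define B where "B = int b ^ t"
  define f where "f = (\<lambda>i. (a + int i * d) mod M div g)"
  define c where "c = q div int b"
  have pos: "M > 0" "g > 0" "B > 0" "int b > 0" using assms(1) by (simp_all add: M_def g_def B_def)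
  have MB: "M = int b * B" by (simp add: M_def B_def)
  have gM: "g dvd M" by (simp add: g_def)
  have qM: "q = M div g" using q by (simp add: M_def g_def)
  have c: "1 \<le> c" unfolding c_def using q(2) pos(4) by (simp add: pos_imp_zdiv_pos_iff int_one_le_iff_zero_less)
  obtain y0 where y0: "{y0..<y0 + c} \<subseteq>
      {y. int s * B \<le> g * y + a mod g \<and> g * y + a mod g < (int s + 1) * B} \<inter> {0..<q}"
    using residues_with_digit[of g B "int b" "int s" a] assms(1) pos gM
    unfolding MB[symmetric] qM[symmetric] c_def[symmetric] by (meson of_nat_0_le_iff of_nat_less_iff)
  \<comment> \<open>Injectivity of \<open>f\<close> is available for one period only, hence the
    truncation at \<open>q\<close>.\<close>
  define n where "n = min k (nat q)"
  have range: "f i \<in> {0..<q}" for i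
  proof -
    have "0 \<le> f i" unfolding f_def using pos by (simp add: pos_imp_zdiv_nonneg_iff)
    moreover have "g * f i \<le> (a + int i * d) mod M"
      unfolding f_def using pos by (metis mult_div_mod_eq pos_mod_sign le_add_same_cancel1)
    then have "g * f i < g * q" using pos gM qM by (simp add: le_less_trans)
    ultimately show ?thesis using pos by simp
  qed
  have miss: "f i \<notin> {y0..<y0 + c}" if "i < k" for i
  proof
    assume "f i \<in> {y0..<y0 + c}"
    then have *: "int s * B \<le> g * f i + a mod g" "g * f i + a mod g < (int s + 1) * B"
      using y0 by auto
    have "(a + int i * d) mod M mod g = a mod g"
    proof -
      obtain d' where "d = g * d'" unfolding g_def by (metis gcd_dvd1 dvdE)
      then show ?thesis using gM by (simp add: mod_mod_cancel mult.left_commute)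
    qed
    then have fx: "g * f i + a mod g = (a + int i * d) mod M"
      unfolding f_def by (metis mult_div_mod_eq)
    have "(a + int i * d) div B mod int b = (a + int i * d) mod M div B"
      using digit_eq_mod_div pos unfolding MB by blast
    also have "\<dots> = int s"
      using * unfolding fx
      by (intro int_div_pos_eq[where r = "(a + int i * d) mod M - int s * B"])
         (simp_all add: algebra_simps)
    finally show False using avoid[OF that] by (simp add: B_def)
  qed
  have "inj_on f {..<nat q}"
    using AP_mod_inj[OF pos(1), of a d] unfolding f_def qM g_def .
  then have "n = card (f ` {..<n})"
    by (subst card_image) (auto simp: n_def inj_on_def)
  also have "f ` {..<n} \<subseteq> {0..<q} - {y0..<y0 + c}"
    using range miss by (auto simp: n_def)
  then have "card (f ` {..<n}) \<le> card ({0..<q} - {y0..<y0 + c})"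
    by (rule card_mono[rotated]) simp
  also have "\<dots> = card {0..<q} - card {y0..<y0 + c}"
    using y0 by (intro card_Diff_subset) auto
  finally have n: "n \<le> nat q - nat c" by simp
  have "c \<le> q" unfolding c_def using q(2) pos(4) zdiv_mono2[of q 1 "int b"] by simp
  then have "int n \<le> q - c" using n c by linarith
  \<comment> \<open>As \<open>q\<close> is at least \<open>b\<close>, \<open>c\<close> is at least
    1; so \<open>n < q\<close> and the minimum is \<open>k\<close>.\<close>
  moreover from this have "n = k" using c by (auto simp: n_def min_def split: if_splits)
  ultimately show ?thesis by (simp add: c_def)
qed

section \<open>Choice of the digit position\<close>

text \<open>Here \<open>q t\<close> is the denominator of \<open>d / b ^ t\<close> in lowest terms.
  It starts at 1, is unbounded, and grows at most by the factor \<open>b\<close> per step, so it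
  cannot jump over the window.\<close>

lemma denominator_in_window:
  fixes d :: int and b :: nat
  assumes "b \<ge> 2" "d \<noteq> 0"
  shows "\<exists>t q. q = int b ^ Suc t div gcd d (int b ^ Suc t) \<and> int b \<le> q \<and> q \<le> int b * int (beta b)"
proof -
  define q where "q = (\<lambda>t. int b ^ t div gcd d (int b ^ t))"
  have q: "int b ^ t = q t * gcd d (int b ^ t)" for t
    by (simp add: q_def)
  have gpos: "gcd d (int b ^ t) > 0" for t using assms by simp
  have qpos: "q t > 0" for t
    using q[of t] gpos[of t] assms by (metis zero_less_mult_pos2 of_nat_0_less_iff zero_less_power pos2 less_le_trans)
  have "\<exists>t. int b \<le> q t"
  proof -
    \<comment> \<open>The gcd is at most \<open>\<bar>d\<bar>\<close> and
      \<open>b ^ nat \<bar>d\<bar>\<close> exceeds \<open>\<bar>d\<bar>\<close>; the extra factor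
      \<open>b\<close> then brings \<open>q t\<close> up to \<open>b\<close>.\<close>
    define t where "t = Suc (nat \<bar>d\<bar>)"
    have "int b * \<bar>d\<bar> \<le> int b ^ t"
    proof -
      have "nat \<bar>d\<bar> < b ^ nat \<bar>d\<bar>" using assms by (intro power_gt_expt) auto
      then have "int (nat \<bar>d\<bar>) \<le> int (b ^ nat \<bar>d\<bar>)" by (simp only: of_nat_le_iff less_imp_le)
      then have "\<bar>d\<bar> \<le> int b ^ nat \<bar>d\<bar>" by simp
      then show ?thesis unfolding t_def power_Suc by (rule mult_left_mono) simp
    qed
    also have "\<dots> = q t * gcd d (int b ^ t)" by (rule q)
    also have "\<dots> \<le> q t * \<bar>d\<bar>"
      using qpos[of t] assms by (intro mult_left_mono) (auto intro!: zdvd_imp_le)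
    finally have "int b \<le> q t" using assms by simp
    then show ?thesis ..
  qed
  define t where "t = (LEAST t. int b \<le> q t)"
  have t: "int b \<le> q t" unfolding t_def using \<open>\<exists>t. int b \<le> q t\<close> by (rule LeastI_ex)
  have "t \<noteq> 0" using t assms by (intro notI) (simp add: q_def)
  then obtain u where u: "t = Suc u" using not0_implies_Suc by blast
  have "q u < int b" using not_less_Least[of u "\<lambda>t. int b \<le> q t"] u by (simp add: t_def)
  have "nat (q u) dvd b ^ u"
  proof -
    have "q u dvd int b ^ u" using q[of u] by (metis dvd_triv_left)
    then have "int (nat (q u)) dvd int (b ^ u)" using qpos[of u] by simp
    then show ?thesis by (simp only: of_nat_dvd_iff)
  qed
  then have "nat (q u) \<le> beta b"
    using beta_properties(4)[OF assms(1)] \<open>q u < int b\<close> qpos[of u] by (simp add: nat_less_iff)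
  then have qu: "q u \<le> int (beta b)" by simp
  \<comment> \<open>The gcd does not shrink while the power gains one factor \<open>b\<close>,
    whence \<open>q t \<le> b * q u\<close>.\<close>
  have "gcd d (int b ^ u) \<le> gcd d (int b ^ t)"
    using gpos u by (intro zdvd_imp_le gcd_mono) auto
  then have "q t * gcd d (int b ^ u) \<le> q t * gcd d (int b ^ t)"
    using qpos[of t] by simp
  also have "\<dots> = int b * int b ^ u" using q[of t] u by simp
  also have "\<dots> = int b * (q u * gcd d (int b ^ u))"
    by (subst q) (rule refl)
  also have "\<dots> = int b * q u * gcd d (int b ^ u)" by simp
  finally have "q t \<le> int b * q u" using gpos[of u] by simp
  also have "\<dots> \<le> int b * int (beta b)" using qu by (simp add: mult_left_mono)
  finally show ?thesis using t u by (auto simp: q_def)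
qed

section \<open>Assembling both bounds\<close>

text \<open>The left side equals \<open>(b - 1) * (q div b) + q mod b\<close>, at most
  \<open>(b - 1) * (q div b + 1)\<close>. This suffices when \<open>q div b < m\<close>; the
  remaining case \<open>q = b * m\<close> gives equality.\<close>

lemma minus_div_le:
  fixes q b m :: int
  assumes "b > 0" "q \<le> b * m"
  shows "q - q div b \<le> (b - 1) * m"
proof (cases "q = b * m")
  case True
  then show ?thesis using assms by (simp add: algebra_simps)
next
  case False
  then have "q < b * m" using assms by simp
  moreover have q: "0 \<le> q mod b" "q mod b < b" "b * (q div b) + q mod b = q"
    using assms by auto
  ultimately have "b * (q div b) < b * m" by linarith
  then have "q div b + 1 \<le> m" using assms(1) by simp
  then have "(b - 1) * (q div b + 1) \<le> (b - 1) * m" using assms by (intro mult_left_mono) auto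
  then show ?thesis using q unfolding left_diff_distrib distrib_left by linarith
qed

lemma contains_AP_length_le:
  assumes "b \<ge> 2" "permitted b S" "contains_AP (kempner_set S b) k"
  shows "k \<le> (b - 1) * beta b"
proof -
  obtain s where "s \<in> {0..b - 1}" "s \<notin> S"
    using assms(2) unfolding permitted_def by blast
  \<comment> \<open>This forces the missing digit to be nonzero, so leading zeros cannot be confused
    with it.\<close>
  moreover have "0 \<in> S" using assms(2) by (simp add: permitted_def)
  ultimately have s: "s < b" "s \<notin> S" "s > 0"
    using assms(1) by (auto intro!: Nat.gr0I)
  obtain a d where d: "d \<noteq> 0" "\<And>i. i < k \<Longrightarrow> a + int i * d \<in> int ` kempner_set S b"
    using assms(3) unfolding contains_AP_def by blast
  obtain t q where q: "q = int b ^ Suc t div gcd d (int b ^ Suc t)" "int b \<le> q"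
      "q \<le> int b * int (beta b)"
    using denominator_in_window[OF assms(1) d(1)] by blast
  have "(a + int i * d) div int b ^ t mod int b \<noteq> int s" if i: "i < k" for i
  proof -
    obtain n where n: "a + int i * d = int n" "n \<in> kempner_set S b" using d(2)[OF i] by blast
    have "int (n div b ^ t mod b) \<noteq> int s"
      using kempner_set_digit_ne[OF n(2) s(2,3)] by (simp only: of_nat_eq_iff not_False_eq_True)
    then show ?thesis unfolding n(1) by (simp add: zdiv_int zmod_int)
  qed
  then have "int k \<le> q - q div int b"
    using s(1) q(1,2) by (intro AP_avoiding_digit_length)
  also have "\<dots> \<le> (int b - 1) * int (beta b)"
    using assms(1) q(3) by (intro minus_div_le) auto
  also have "\<dots> = int ((b - 1) * beta b)"
    using assms(1) by (simp add: of_nat_diff)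
  finally show ?thesis by (simp only: of_nat_le_iff)
qed

theorem theorem1p1:
  fixes b :: nat
  assumes "b \<ge> 2"
  shows "ell b = enat ((b - 1) * beta b)"
proof (rule antisym)
  show "ell b \<le> enat ((b - 1) * beta b)"
    unfolding ell_def using contains_AP_length_le[OF assms] by (intro Sup_least) auto
  \<comment> \<open>Only the top digit is left out; \<open>b \<ge> 2\<close> keeps 0 in the
    set.\<close>
  have "permitted b {0..<b - 1}"
    using assms by (auto simp: permitted_def set_eq_iff)
  then show "enat ((b - 1) * beta b) \<le> ell b"
    unfolding ell_def using contains_AP_beta[OF assms] by (intro Sup_upper) blast
qed

end
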